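(* Let $C_\varphi$ be a bicolourable framed chord diagram, with interlace graph $G$ having adjacency matrix $\mathfrak{e}$. Its associated intersection form $\mathfrak{i}_\varphi$, colour form $\mathfrak{c}_\chi$ and Rosenstiehl form $\mathfrak{r}=\mathfrak{e}+\mathfrak{e}^2$ are related, as functions $V_G\times V_G\to\mathbb{Z}/2$, by $$\mathfrak{i}_\varphi-\mathfrak{c}_\chi\equiv\mathfrak{e}+\mathfrak{e}^2.$$ Hence the intersection form can be computed from the bicoloured graph. Moreover $\mathfrak{i}_\varphi$ determines $\mathfrak{c}_\chi$, whence $\varphi$ up to inversions on connected components of the interlace graph. In particular, when any two distinct non-adjacent vertices of $G$ have an even number of common neighbours, namely when $\mathfrak{e}^2$ vanishes modulo $2$ on the non-edges, the intersection form can be computed from the graph and its colour coboundary $d\chi\in B^1(G;\mathbb{Z}/2)$.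
   Context: A chord diagram is a finite cyclic word $C$ in which every letter appears exactly twice, up to relabelling; its letters are called chords. A framing of $C$ is a function $\varphi\colon C\to\{0,\infty\}$ giving different values to the two occurrences of each letter; the occurrences of $x$ are then denoted $x_0,x_\infty$. The interlace graph $G$ has vertex set $V_G$ the set of chords and edge set $E_G$ the pairs of chords whose occurrences alternate along the cyclic word; $\mathfrak{e}\colon V_G\times V_G\to\{0,1\}$ is its adjacency matrix. The chord diagram is bicolourable when every vertex of $G$ has even degree. For distinct occurrences $p,q$ in $C$, $(p,q)$ is the open interval of occurrences met strictly between $p$ and $q$ when travelling from $p$ to $q$ in the cyclic order. With $1/0=\infty$, $1/\infty=0$, the intersection form is $$\mathfrak{i}_\varphi(x,y)=\mathfrak{e}(x,y)+\operatorname{Card}\{z_j\in C_\varphi\mid z_j\in(x_\infty,x_0)\text{ and }z_{1/j}\in(y_\infty,y_0)\}\in\mathbb{Z}/2.$$ A filoop is a generic immersion $\gamma\colon\mathbb{S}^1\to F$ (all multiple points transverse double points) in a smooth closed connected oriented surface with $F\setminus\gamma$ a disjoint union of discs, up to orientation preserving diffeomorphisms of source and target; each double point $x$ has preimages $x_\infty,x_0$ ordered so that the tangent vectors $(\vec\gamma(x_\infty),\vec\gamma(x_0))$ form a positive basis of $T_xF$, which gives a framed chord diagram, and each framed chord diagram $C_\varphi$ arises from a unique filoop. When $C$ is bicolourable, $F\setminus\gamma$ has exactly two bicolourings $F\setminus\gamma\to\{\bullet,\circ\}$ that change colour when crossing $\gamma$ at smooth points, exchanged by global change of colour. Choosing one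 of them, the bicolouring $\chi\colon V_G\to\{\bullet,\circ\}$ associated to $\varphi$ colours each intersection $x$ by the colour of the region in the direction $\vec\gamma(x_\infty)+\vec\gamma(x_0)$. Equivalently, up to global change of colour, consecutive letters of $C$ have the same framing value if and only if they have different colours. The colour form $\mathfrak{c}_\chi\colon V_G\times V_G\to\{0,1\}$ is the differential of the indicator function of $V_\bullet=\chi^{-1}(\bullet)$ or of $V_\circ=\chi^{-1}(\circ)$: for all $x,y\in V_G$, $\mathfrak{c}_\chi(x,y)=1$ if $\chi(x)\ne\chi(y)$ and $0$ otherwise. Its restriction to the edges of $G$ is the colour coboundary $d\chi\in B^1(G;\mathbb{Z}/2)$, where $B^1(G;\mathbb{Z}/2)$ is the space of $1$-coboundaries of $G$.
   Formalization: The colour form is replaced by its restriction to edges, extended by zero, in the identity and in "determines the colour form"; as stated both fail on non-adjacent chords of different colours, e.g. for a_0 a_∞ b_∞ b_0. *)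

theory Defs
  imports Main "HOL-Library.Z2"
begin

text \<open>
  A cyclic word is given by a list \<open>C\<close> representing it, its last entry being followed by its
  first one.  The occurrences of letters are the positions \<open>p < length C\<close>.
\<close>

definition chord_diagram :: "'a list \<Rightarrow> bool" where
  "chord_diagram C \<longleftrightarrow> (\<forall>x\<in>set C. count_list C x = 2)"

abbreviation chords :: "'a list \<Rightarrow> 'a set" where
  "chords C \<equiv> set C"


section \<open>The interlace graph\<close>

definition interlaced :: "'a list \<Rightarrow> 'a \<Rightarrow> 'a \<Rightarrow> bool" where
  "interlaced C x y \<longleftrightarrow> x \<noteq> y \<and>
     (\<exists>p q r s. p < q \<and> q < r \<and> r < s \<and> s < length C \<and>
        ((C ! p = x \<and> C ! q = y \<and> C ! r = x \<and> C ! s = y) \<or>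
         (C ! p = y \<and> C ! q = x \<and> C ! r = y \<and> C ! s = x)))"

definition adjacency :: "'a list \<Rightarrow> 'a \<Rightarrow> 'a \<Rightarrow> bit" where
  "adjacency C x y = of_bool (interlaced C x y)"

definition adjacency_squared :: "'a list \<Rightarrow> 'a \<Rightarrow> 'a \<Rightarrow> bit" where
  "adjacency_squared C x y = (\<Sum>z\<in>chords C. adjacency C x z * adjacency C z y)"

definition rosenstiehl_form :: "'a list \<Rightarrow> 'a \<Rightarrow> 'a \<Rightarrow> bit" where
  "rosenstiehl_form C x y = adjacency C x y + adjacency_squared C x y"

definition bicolourable :: "'a list \<Rightarrow> bool" where
  "bicolourable C \<longleftrightarrow> (\<forall>x\<in>chords C. even (card {y \<in> chords C. interlaced C x y}))"

definition connected_components :: "'a list \<Rightarrow> 'a set set" where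
  "connected_components C = (\<lambda>x. {y \<in> chords C. (interlaced C)\<^sup>*\<^sup>* x y}) ` chords C"

definition even_common_neighbours :: "'a list \<Rightarrow> bool" where
  "even_common_neighbours C \<longleftrightarrow>
     (\<forall>x\<in>chords C. \<forall>y\<in>chords C. x \<noteq> y \<longrightarrow> \<not> interlaced C x y \<longrightarrow>
        even (card {z \<in> chords C. interlaced C x z \<and> interlaced C y z}))"

definition graph_iso :: "'a list \<Rightarrow> 'b list \<Rightarrow> ('a \<Rightarrow> 'b) \<Rightarrow> bool" where
  "graph_iso C D f \<longleftrightarrow> bij_betw f (chords C) (chords D) \<and>
     (\<forall>x\<in>chords C. \<forall>y\<in>chords C. interlaced D (f x) (f y) \<longleftrightarrow> interlaced C x y)"


section \<open>Framings and the intersection form\<close>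

datatype frame_value = Zero | Infty

fun recip :: "frame_value \<Rightarrow> frame_value" where
  "recip Zero = Infty"
| "recip Infty = Zero"

definition framing :: "'a list \<Rightarrow> (nat \<Rightarrow> frame_value) \<Rightarrow> bool" where
  "framing C \<phi> \<longleftrightarrow>
     (\<forall>p<length C. \<forall>q<length C. p \<noteq> q \<longrightarrow> C ! p = C ! q \<longrightarrow> \<phi> p \<noteq> \<phi> q)"

text \<open>\<open>occurrence C \<phi> x j\<close> is the position of the occurrence $x_j$.\<close>

definition occurrence :: "'a list \<Rightarrow> (nat \<Rightarrow> frame_value) \<Rightarrow> 'a \<Rightarrow> frame_value \<Rightarrow> nat" where
  "occurrence C \<phi> x j = (THE p. p < length C \<and> C ! p = x \<and> \<phi> p = j)"

text \<open>The open interval $(p,q)$ of the cyclic order, for \<open>p \<noteq> q\<close>.\<close>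

definition cyclic_interval :: "'a list \<Rightarrow> nat \<Rightarrow> nat \<Rightarrow> nat set" where
  "cyclic_interval C p q =
     (if p < q then {p<..<q} else {p<..<length C} \<union> {..<q})"

definition intersection_form ::
    "'a list \<Rightarrow> (nat \<Rightarrow> frame_value) \<Rightarrow> 'a \<Rightarrow> 'a \<Rightarrow> bit" where
  "intersection_form C \<phi> x y =
     adjacency C x y +
     of_nat (card {p. p < length C \<and>
       p \<in> cyclic_interval C (occurrence C \<phi> x Infty) (occurrence C \<phi> x Zero) \<and>
       occurrence C \<phi> (C ! p) (recip (\<phi> p))
         \<in> cyclic_interval C (occurrence C \<phi> y Infty) (occurrence C \<phi> y Zero)})"

text \<open>\<open>\<psi>\<close> is obtained from \<open>\<phi>\<close> by exchanging $0$ and $\infty$ on all the chords of some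
  connected components of the interlace graph.\<close>

definition equal_up_to_component_inversions ::
    "'a list \<Rightarrow> (nat \<Rightarrow> frame_value) \<Rightarrow> (nat \<Rightarrow> frame_value) \<Rightarrow> bool" where
  "equal_up_to_component_inversions C \<phi> \<psi> \<longleftrightarrow>
     (\<exists>K \<subseteq> connected_components C. \<forall>p<length C.
        \<psi> p = (if C ! p \<in> \<Union>K then recip (\<phi> p) else \<phi> p))"


section \<open>Bicolourings and the colour form\<close>

datatype colour = Black | White

text \<open>
  The bicolouring of the intersections of the filoop of \<open>(C, \<phi>)\<close> in terms of the framed word:
  consecutive letters have the same framing value iff they have different colours.  When \<open>C\<close> is
  a nonempty bicolourable chord diagram, exactly two functions on the chords satisfy this,
  exchanged by the global change of colour.
\<close>

definition associated_bicolouring ::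
    "'a list \<Rightarrow> (nat \<Rightarrow> frame_value) \<Rightarrow> ('a \<Rightarrow> colour) \<Rightarrow> bool" where
  "associated_bicolouring C \<phi> \<chi> \<longleftrightarrow>
     (\<forall>p<length C. let q = Suc p mod length C in
        \<phi> p = \<phi> q \<longleftrightarrow> \<chi> (C ! p) \<noteq> \<chi> (C ! q))"

definition bicolourable_framed_diagram ::
    "'a list \<Rightarrow> (nat \<Rightarrow> frame_value) \<Rightarrow> ('a \<Rightarrow> colour) \<Rightarrow> bool" where
  "bicolourable_framed_diagram C \<phi> \<chi> \<longleftrightarrow>
     chord_diagram C \<and> bicolourable C \<and> framing C \<phi> \<and> associated_bicolouring C \<phi> \<chi>"

definition colour_form :: "('a \<Rightarrow> colour) \<Rightarrow> 'a \<Rightarrow> 'a \<Rightarrow> bit" where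
  "colour_form \<chi> x y = of_bool (\<chi> x \<noteq> \<chi> y)"

text \<open>
  The colour coboundary $d\chi$: the restriction of the colour form to the edges of the interlace
  graph, extended by zero to pairs of chords that are not edges.
\<close>

definition colour_coboundary :: "'a list \<Rightarrow> ('a \<Rightarrow> colour) \<Rightarrow> 'a \<Rightarrow> 'a \<Rightarrow> bit" where
  "colour_coboundary C \<chi> x y = (if interlaced C x y then colour_form \<chi> x y else 0)"

text \<open>
  The colour form has to be understood as a cochain of the graph, that is as \<open>colour_coboundary\<close>,
  in its relation to the intersection form.  Inverting the framing of a single chord \<open>x\<close> changes
  the colour of \<open>x\<close> only, hence \<open>colour_form \<chi> x y\<close> for every other chord \<open>y\<close>, whereas it
  changes the intersection form at \<open>(x, y)\<close> only when \<open>x\<close> and \<open>y\<close> are adjacent.  So the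
  difference of the intersection form and the colour form on all pairs of chords cannot be
  a function of the graph, and the intersection form does not determine the colour form on pairs
  of distinct non-adjacent chords.  The cyclic word $a_0 a_\infty b_\infty b_0$ is an example.
\<close>

lemma colour_form_on_non_edges:
  fixes a b :: 'a
  assumes "a \<noteq> b"
  defines "C \<equiv> [a, a, b, b]"
    and "\<phi> \<equiv> (!) [Zero, Infty, Infty, Zero]"
    and "\<chi> \<equiv> (\<lambda>x. if x = a then Black else White)"
  shows "bicolourable_framed_diagram C \<phi> \<chi>"
    and "intersection_form C \<phi> a b - colour_form \<chi> a b \<noteq> rosenstiehl_form C a b"
proof -
  have less4: "p < Suc (Suc (Suc (Suc 0))) \<longleftrightarrow> p = 0 \<or> p = 1 \<or> p = 2 \<or> p = 3" for p :: nat
    by auto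
  have not_interlaced: "\<not> interlaced C x y" for x y
  proof
    assume "interlaced C x y"
    then obtain p q r s where "p < q" "q < r" "r < s" "s < 4" "C ! p = C ! r" "C ! p \<noteq> C ! q"
      unfolding interlaced_def C_def by auto
    moreover from this have "p = 0" "q = 1" "r = 2" "s = 3" by auto
    ultimately show False by (simp add: C_def)
  qed
  show "bicolourable_framed_diagram C \<phi> \<chi>"
    using assms(1) not_interlaced
    by (auto simp: bicolourable_framed_diagram_def chord_diagram_def bicolourable_def framing_def
        associated_bicolouring_def C_def \<phi>_def \<chi>_def less4 Let_def)
  have occ: "occurrence C \<phi> b Infty = 2" "occurrence C \<phi> b Zero = 3"
    unfolding occurrence_def using assms(1)
    by (auto intro!: the_equality simp: C_def \<phi>_def less4)
  have "cyclic_interval C (occurrence C \<phi> b Infty) (occurrence C \<phi> b Zero) = {}"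
    by (auto simp: occ cyclic_interval_def)
  then show "intersection_form C \<phi> a b - colour_form \<chi> a b \<noteq> rosenstiehl_form C a b"
    using assms(1) not_interlaced
    by (simp add: intersection_form_def rosenstiehl_form_def adjacency_squared_def adjacency_def
        colour_form_def \<chi>_def)
qed

end

theory Submission
  imports Defs
begin

text \<open>
  Let $I_x$ be the arc from $x_\infty$ to $x_0$.  Modulo 2, the adjacency of $x$ and $z$ is
  $I_x(z_\infty) + I_x(z_0)$ for all chords, including $z = x$.  Expanding the products in the square
  of the adjacency matrix gives the count in the intersection form plus the cardinality of
  $I_x \cap I_y$.  Bicolourability says that all arcs are even.  So $I_x \cap I_y$ is even unless $x$
  and $y$ are interlaced; then it is a single arc between an occurrence of $x$ and one of $y$, and its
  parity is that of $x_\infty - y_\infty$, which the step rule for the bicolouring identifies with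
  the difference of the colours.
\<close>

text \<open>With these rules active, sums and products of bits turn into \<open>XOR\<close> and
  \<open>AND\<close>, out of reach of the ring laws used below.\<close>

declare add_bit_eq_xor [simp del] mult_bit_eq_and [simp del]

section \<open>Bits, and parities of intersections of arcs\<close>

lemma bit_add_eq_move: "a + b = c \<Longrightarrow> a = c + b" for a b c :: bit
  by (cases a; cases b) auto

lemma bit_of_nat: "(of_nat n :: bit) = of_bool (odd n)"
  by (induction n) simp_all

text \<open>If both or neither of \<open>c\<close>, \<open>d\<close> lie in \<open>I\<close>, then
  \<open>I \<inter> J\<close> is empty, one of the two arcs, or \<open>I\<close> without a smaller
  arc and its ends; all have even size. If just one does, it is the arc from \<open>c\<close> to
  \<open>b\<close> or from \<open>a\<close> to \<open>d\<close>, of size congruent to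
  \<open>a + c\<close>. The cases record which arcs pass the end of the list.\<close>

lemma odd_card_arc_Int:
  assumes lt: "a < length C" "b < length C" "c < length C" "d < length C"
    and ne: "a \<noteq> b" "c \<noteq> d" "a \<noteq> c" "a \<noteq> d" "b \<noteq> c" "b \<noteq> d"
    and "even (length C)" "odd (a + b)" "odd (c + d)"
  defines "I \<equiv> cyclic_interval C a b" and "J \<equiv> cyclic_interval C c d"
  shows "odd (card (I \<inter> J)) \<longleftrightarrow> (c \<in> I) \<noteq> (d \<in> I) \<and> odd (a + c)"
proof -
  let ?n = "length C"
  have par: "even a = odd b" "even c = odd d" "even ?n"
    using assms by simp_all
  have order: "a < c \<or> c < a" "a < d \<or> d < a" "b < c \<or> c < b" "b < d \<or> d < b"
    using ne by auto
  consider "a < b" | "b < a" using ne by linarith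
  then show ?thesis
  proof cases
    case ab: 1
    have mem: "c \<in> I \<longleftrightarrow> a < c \<and> c < b" "d \<in> I \<longleftrightarrow> a < d \<and> d < b"
      using ab by (simp_all add: I_def cyclic_interval_def)
    consider "c < d" | "d < c" using ne by linarith
    then show ?thesis
    proof cases
      case cd: 1
      have "I \<inter> J = {max a c<..<min b d}"
        using ab cd by (auto simp: I_def J_def cyclic_interval_def)
      \<comment> \<open>Subtraction is truncated, so the formula also gives 0 for an empty
        interval.\<close>
      then have "card (I \<inter> J) = min b d - Suc (max a c)" by simp
      then show ?thesis
        unfolding mem using order ab cd
        by (elim disjE; simp add: max_def min_def; use par in blast)
    next
      case cd: 2
      have "I \<inter> J = {max a c<..<b} \<union> {a<..<min b d}"
        using ab cd lt by (auto simp: I_def J_def cyclic_interval_def)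
      moreover have "{max a c<..<b} \<inter> {a<..<min b d} = {}" using cd by auto
      ultimately have "card (I \<inter> J) = b - Suc (max a c) + (min b d - Suc a)"
        by (simp add: card_Un_disjoint)
      then show ?thesis
        unfolding mem using order ab cd
        by (elim disjE; simp add: max_def min_def; use par in blast)
    qed
  next
    case ab: 2
    have mem: "c \<in> I \<longleftrightarrow> c < b \<or> a < c" "d \<in> I \<longleftrightarrow> d < b \<or> a < d"
      using ab lt by (auto simp: I_def cyclic_interval_def)
    consider "c < d" | "d < c" using ne by linarith
    then show ?thesis
    proof cases
      case cd: 1
      have "I \<inter> J = {max a c<..<d} \<union> {c<..<min b d}"
        using ab cd lt by (auto simp: I_def J_def cyclic_interval_def)
      moreover have "{max a c<..<d} \<inter> {c<..<min b d} = {}" using ab by auto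
      ultimately have "card (I \<inter> J) = d - Suc (max a c) + (min b d - Suc c)"
        by (simp add: card_Un_disjoint)
      then show ?thesis
        unfolding mem using order ab cd
        by (elim disjE; simp add: max_def min_def; use par in blast)
    next
      case cd: 2
      \<comment> \<open>Both arcs pass the end of the list; the four pieces are the pairwise
        intersections of their upper and lower parts.\<close>
      have "I \<inter> J = ({max a c<..<?n} \<union> {..<min b d}) \<union> ({a<..<d} \<union> {c<..<b})"
        using lt ab cd by (auto simp: I_def J_def cyclic_interval_def)
      moreover have "({max a c<..<?n} \<union> {..<min b d}) \<inter> ({a<..<d} \<union> {c<..<b}) = {}"
        "{max a c<..<?n} \<inter> {..<min b d} = {}" "{a<..<d} \<inter> {c<..<b} = {}"
        using ab cd by auto
      ultimately have "card (I \<inter> J)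
          = (?n - Suc (max a c) + min b d) + ((d - Suc a) + (b - Suc c))"
        by (simp add: card_Un_disjoint)
      then show ?thesis
        unfolding mem using order ab cd lt(1,3)
        by (elim disjE; simp add: max_def min_def; use par in blast)
    qed
  qed
qed

section \<open>Arcs of a framing and the interlace graph\<close>

lemma interlaced_sym: "interlaced C x y \<longleftrightarrow> interlaced C y x"
  unfolding interlaced_def by blast

lemma adjacency_sym: "adjacency C x y = adjacency C y x"
  by (simp add: adjacency_def interlaced_sym)

locale framed_diagram =
  fixes C :: "'a list" and \<phi> :: "nat \<Rightarrow> frame_value"
  assumes diagram: "chord_diagram C" and framing: "framing C \<phi>"
begin

abbreviation occ :: "'a \<Rightarrow> frame_value \<Rightarrow> nat" where
  "occ \<equiv> occurrence C \<phi>"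

abbreviation arc :: "'a \<Rightarrow> nat set" where
  "arc x \<equiv> cyclic_interval C (occ x Infty) (occ x Zero)"

text \<open>A chord has two positions and the framing separates them, so each value is taken exactly
  once; this justifies the \<open>THE\<close> in \<open>occurrence\<close>.\<close>

lemma occurrence_pair:
  assumes "x \<in> chords C"
  shows occ_less: "occ x j < length C"
    and nth_occ: "C ! occ x j = x"
    and frame_occ: "\<phi> (occ x j) = j"
    and positions_eq: "{p. p < length C \<and> C ! p = x} = {occ x Infty, occ x Zero}"
    and occ_neq: "occ x Infty \<noteq> occ x Zero"
proof -
  have "count_list C x = card {p. p < length C \<and> C ! p = x}"
    unfolding count_list_eq_length_filter length_filter_conv_card by (metis (full_types))
  then have "card {p. p < length C \<and> C ! p = x} = 2"
    using diagram assms by (simp add: chord_diagram_def)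
  then obtain p q where pq: "{p. p < length C \<and> C ! p = x} = {p, q}" "p \<noteq> q"
    by (auto simp: card_2_iff)
  then have in_pq: "p < length C" "C ! p = x" "q < length C" "C ! q = x" by blast+
  then have "\<phi> p \<noteq> \<phi> q"
    using framing pq(2) by (auto simp: framing_def)
  then obtain a b where ab: "{p, q} = {a, b}" "\<phi> a = Infty" "\<phi> b = Zero"
    by (cases "\<phi> p"; cases "\<phi> q") auto
  then have eq: "{p. p < length C \<and> C ! p = x} = {a, b}"
    using pq by simp
  have iff: "p < length C \<and> C ! p = x \<longleftrightarrow> p = a \<or> p = b" for p
    using eq by blast
  have "occ x Infty = a" "occ x Zero = b"
    unfolding occurrence_def conj_assoc[symmetric] iff using ab by (auto intro!: the_equality)
  moreover have "a \<noteq> b" using ab by auto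
  ultimately show "occ x j < length C" "C ! occ x j = x" "\<phi> (occ x j) = j"
    "{p. p < length C \<and> C ! p = x} = {occ x Infty, occ x Zero}" "occ x Infty \<noteq> occ x Zero"
    using iff ab eq by (cases j; auto)+
qed

lemma position_cases:
  assumes "p < length C"
  shows "p = occ (C ! p) (\<phi> p)"
proof -
  have x: "C ! p \<in> chords C" using assms by simp
  then have "p \<in> {occ (C ! p) Infty, occ (C ! p) Zero}"
    using assms unfolding positions_eq[OF x, symmetric] by blast
  then show ?thesis
    using frame_occ[OF x, of Infty] frame_occ[OF x, of Zero] by auto
qed

text \<open>The bridge from counting positions in arcs to sums over vertices of the interlace
  graph.\<close>

lemma sum_positions:
  fixes f :: "nat \<Rightarrow> 'c::comm_monoid_add"
  shows "(\<Sum>p<length C. f p) = (\<Sum>z\<in>chords C. f (occ z Infty) + f (occ z Zero))"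
proof -
  have "(\<Sum>p<length C. f p) = (\<Sum>z\<in>chords C. sum f {p \<in> {..<length C}. C ! p = z})"
    by (rule sum.group[symmetric]) auto
  also have "\<dots> = (\<Sum>z\<in>chords C. f (occ z Infty) + f (occ z Zero))"
    using positions_eq occ_neq by (intro sum.cong) simp_all
  finally show ?thesis .
qed

lemma even_length: "even (length C)"
  using sum_positions[of "\<lambda>_. 1::nat"] by simp

text \<open>Alternation does not depend on where the cyclic word is cut open, nor on which end of a
  chord comes first.\<close>

lemma interlaced_iff_arc:
  assumes "x \<in> chords C" "y \<in> chords C" "x \<noteq> y"
  shows "interlaced C x y \<longleftrightarrow> (occ y Infty \<in> arc x) \<noteq> (occ y Zero \<in> arc x)"
proof -
  define a b c d where "a = occ x Infty" and "b = occ x Zero"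
    and "c = occ y Infty" and "d = occ y Zero"
  note defs = this
  have at: "C ! a = x" "C ! b = x" "C ! c = y" "C ! d = y"
    and lt: "a < length C" "b < length C" "c < length C" "d < length C"
    and ne: "a \<noteq> b" "c \<noteq> d" "a \<noteq> c" "a \<noteq> d" "b \<noteq> c" "b \<noteq> d"
    using assms nth_occ[OF assms(1)] nth_occ[OF assms(2)] occ_less occ_neq
    unfolding defs by metis+
  have x: "p < length C \<Longrightarrow> C ! p = x \<Longrightarrow> p = a \<or> p = b" for p
    using positions_eq[OF assms(1)] unfolding defs by blast
  have y: "p < length C \<Longrightarrow> C ! p = y \<Longrightarrow> p = c \<or> p = d" for p
    using positions_eq[OF assms(2)] unfolding defs by blast
  \<comment> \<open>Unordered pairs allow witnesses sorted by \<open>min\<close> and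
    \<open>max\<close>, whichever end carries \<open>Infty\<close>.\<close>
  have wit: "interlaced C x y" if "p < q" "q < r" "r < s"
    "{p, r} = {a, b} \<and> {q, s} = {c, d} \<or> {p, r} = {c, d} \<and> {q, s} = {a, b}" for p q r s
  proof -
    have "s < length C" using that(4) lt by (auto simp: doubleton_eq_iff)
    moreover have "C ! p = x \<and> C ! q = y \<and> C ! r = x \<and> C ! s = y \<or>
      C ! p = y \<and> C ! q = x \<and> C ! r = y \<and> C ! s = x"
      using that(4) at by (auto simp: doubleton_eq_iff)
    ultimately show ?thesis
      using that(1-3) assms(3) unfolding interlaced_def by blast
  qed
  have "interlaced C x y \<longleftrightarrow> (c \<in> cyclic_interval C a b) \<noteq> (d \<in> cyclic_interval C a b)"
  proof
    assume "interlaced C x y"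
    then obtain p q r s where o: "p < q" "q < r" "r < s" "s < length C"
      and "C ! p = x \<and> C ! q = y \<and> C ! r = x \<and> C ! s = y \<or>
        C ! p = y \<and> C ! q = x \<and> C ! r = y \<and> C ! s = x"
      unfolding interlaced_def by blast
    then have "(p = a \<or> p = b) \<and> (r = a \<or> r = b) \<and> (q = c \<or> q = d) \<and> (s = c \<or> s = d) \<or>
      (p = c \<or> p = d) \<and> (r = c \<or> r = d) \<and> (q = a \<or> q = b) \<and> (s = a \<or> s = b)"
      using x[of p] x[of q] x[of r] x[of s] y[of p] y[of q] y[of r] y[of s] by auto
    then show "(c \<in> cyclic_interval C a b) \<noteq> (d \<in> cyclic_interval C a b)"
      using o by (elim disjE conjE) (auto simp: cyclic_interval_def)
  next
    assume "(c \<in> cyclic_interval C a b) \<noteq> (d \<in> cyclic_interval C a b)"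
    \<comment> \<open>If \<open>b < a\<close>, the arc is the complement of the closed interval from
      \<open>b\<close> to \<open>a\<close>: both memberships are negated and their inequality
      persists.\<close>
    then have c_d: "(min a b < c \<and> c < max a b) \<noteq> (min a b < d \<and> d < max a b)"
      using ne lt by (auto simp: cyclic_interval_def min_def max_def)
    have min_max: "(min a b < min c d \<and> min c d < max a b)
        \<noteq> (min a b < max c d \<and> max c d < max a b)"
    proof (cases "c < d")
      case True
      then show ?thesis using c_d by simp
    next
      case False
      then show ?thesis using c_d ne by simp
    qed
    have lt_max: "min a b < max a b" "min c d < max c d"
      using ne by (simp_all add: min_def max_def)
    have "min a b \<noteq> min c d" "max a b \<noteq> max c d" "min a b \<noteq> max c d" "max a b \<noteq> min c d"
      using ne by (simp_all add: min_def max_def)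
    then consider
        "min a b < min c d" "min c d < max a b" "max a b < max c d"
      | "min c d < min a b" "min a b < max c d" "max c d < max a b"
      using min_max lt_max by (meson less_trans nat_neq_iff)
    then show "interlaced C x y"
    proof cases
      case 1
      then show ?thesis by (intro wit[of "min a b" "min c d" "max a b" "max c d"])
        (auto simp: min_def max_def)
    next
      case 2
      then show ?thesis by (intro wit[of "min c d" "min a b" "max c d" "max a b"])
        (auto simp: min_def max_def)
    qed
  qed
  then show ?thesis by (simp add: defs)
qed

lemma occ_notin_arc: "x \<in> chords C \<Longrightarrow> occ x j \<notin> arc x"
  using occ_neq[of x] by (cases j) (auto simp: cyclic_interval_def)

text \<open>On the diagonal both sides vanish, as an open arc omits its ends. Elsewhere the sum of
  two bits is their exclusive or.\<close>

lemma adjacency_arc: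
  assumes "x \<in> chords C" "z \<in> chords C"
  shows "adjacency C x z = of_bool (occ z Infty \<in> arc x) + of_bool (occ z Zero \<in> arc x)"
proof (cases "x = z")
  case True
  then show ?thesis using occ_notin_arc assms by (simp add: adjacency_def interlaced_def)
next
  case False
  then show ?thesis
    unfolding adjacency_def interlaced_iff_arc[OF assms False] by (auto simp: of_bool_def)
qed

lemma arc_subset: "x \<in> chords C \<Longrightarrow> arc x \<subseteq> {..<length C}"
  using occ_less[of x Infty] occ_less[of x Zero] by (auto simp: cyclic_interval_def)

text \<open>Relates the size of an arc to the degree of its chord, so that bicolourability becomes
  evenness of arcs.\<close>

lemma card_arc:
  assumes "x \<in> chords C"
  shows "(of_nat (card (arc x)) :: bit) = (\<Sum>z\<in>chords C. adjacency C x z)"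
proof -
  have "(of_nat (card (arc x)) :: bit) = (\<Sum>p<length C. of_bool (p \<in> arc x))"
    using arc_subset[OF assms] by (simp add: Int_absorb1)
  also have "\<dots> = (\<Sum>z\<in>chords C. adjacency C x z)"
    using adjacency_arc[OF assms] by (simp add: sum_positions)
  finally show ?thesis .
qed

text \<open>Each chord \<open>z\<close> contributes a product of two binary sums to \<open>adjacency_squared\<close>: its two
  diagonal terms count the occurrences of \<open>z\<close> in both arcs, its two mixed terms those counted by the
  intersection form.\<close>

lemma intersection_form_arcs:
  assumes "x \<in> chords C" "y \<in> chords C"
  shows "intersection_form C \<phi> x y
    = rosenstiehl_form C x y + of_nat (card (arc x \<inter> arc y))"
proof -
  \<comment> \<open>The position of the other occurrence of the letter at \<open>p\<close>.\<close>
  let ?o = "\<lambda>p. occ (C ! p) (recip (\<phi> p))"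
  let ?N = "card {p. p < length C \<and> p \<in> arc x \<and> ?o p \<in> arc y}"
  let ?X = "\<lambda>p. of_bool (p \<in> arc x) :: bit" and ?Y = "\<lambda>p. of_bool (p \<in> arc y) :: bit"
  have "of_nat ?N = (\<Sum>p<length C. ?X p * ?Y (?o p))"
    unfolding of_bool_conj[symmetric] by (simp add: Int_def)
  moreover have "of_nat (card (arc x \<inter> arc y)) = (\<Sum>p<length C. ?X p * ?Y p)"
    using arc_subset[OF assms(1)] unfolding of_bool_conj[symmetric]
    by (auto intro!: arg_cong[where f = "\<lambda>A. of_nat (card A)"])
  \<comment> \<open>The second factor takes the same value at both occurrences of a letter, so the
    sum factors chord by chord.\<close>
  ultimately have "of_nat ?N + of_nat (card (arc x \<inter> arc y))
      = (\<Sum>p<length C. ?X p * (?Y (?o p) + ?Y p))"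
    by (simp add: sum.distrib distrib_left)
  also have "\<dots> = (\<Sum>z\<in>chords C. adjacency C x z * adjacency C z y)"
    unfolding sum_positions
  proof (rule sum.cong[OF refl])
    fix z assume z: "z \<in> chords C"
    let ?a = "occ z Infty" and ?b = "occ z Zero"
    have "?X ?a * (?Y (?o ?a) + ?Y ?a) + ?X ?b * (?Y (?o ?b) + ?Y ?b)
        = ?X ?a * (?Y ?b + ?Y ?a) + ?X ?b * (?Y ?a + ?Y ?b)"
      using z by (simp only: nth_occ frame_occ recip.simps)
    also have "\<dots> = (?X ?a + ?X ?b) * (?Y ?a + ?Y ?b)"
      by (simp only: distrib_right add.commute[of "?Y ?b"])
    also have "\<dots> = adjacency C x z * adjacency C z y"
      using assms z by (simp only: adjacency_arc adjacency_sym[of C z y])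
    finally show "?X ?a * (?Y (?o ?a) + ?Y ?a) + ?X ?b * (?Y (?o ?b) + ?Y ?b)
        = adjacency C x z * adjacency C z y" .
  qed
  finally have "of_nat ?N + of_nat (card (arc x \<inter> arc y)) = adjacency_squared C x y"
    by (simp add: adjacency_squared_def)
  then have "of_nat ?N = adjacency_squared C x y + of_nat (card (arc x \<inter> arc y))"
    by (rule bit_add_eq_move)
  then show ?thesis
    by (simp only: intersection_form_def rosenstiehl_form_def add.assoc)
qed

end

section \<open>Parities of arcs and positions in the bicolourable case\<close>

locale bicolourable_diagram = framed_diagram +
  assumes bicolourable: "bicolourable C"
begin

lemma even_card_arc:
  assumes "x \<in> chords C"
  shows "even (card (arc x))"
proof -
  have "(\<Sum>z\<in>chords C. adjacency C x z) = of_nat (card {z \<in> chords C. interlaced C x z})"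
    by (simp add: adjacency_def Int_def)
  also have "\<dots> = 0"
    using bicolourable assms by (simp add: bicolourable_def bit_of_nat)
  finally show ?thesis
    using card_arc[OF assms] by (simp add: bit_of_nat)
qed

text \<open>An even open arc puts its ends at odd distance; if it passes the end of the list, the
  even length of the word preserves this.\<close>

lemma odd_occ:
  assumes "x \<in> chords C"
  shows "odd (occ x Infty + occ x Zero)"
proof (cases "occ x Infty < occ x Zero")
  case True
  then show ?thesis
    using even_card_arc[OF assms] by (simp add: cyclic_interval_def)
next
  case False
  then have lt: "occ x Zero < occ x Infty"
    using occ_neq[OF assms] by simp
  then have "{occ x Infty<..<length C} \<inter> {..<occ x Zero} = {}" by auto
  then have "card (arc x) = length C - Suc (occ x Infty) + occ x Zero"
    using lt by (simp add: cyclic_interval_def card_Un_disjoint)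
  then show ?thesis
    using even_card_arc[OF assms] even_length occ_less[OF assms, of Infty] by auto
qed

lemma odd_card_arcs:
  assumes x: "x \<in> chords C" and y: "y \<in> chords C"
  shows "odd (card (arc x \<inter> arc y)) \<longleftrightarrow> interlaced C x y \<and> odd (occ x Infty + occ y Infty)"
proof (cases "x = y")
  case True
  \<comment> \<open>The intersection is the arc itself, which is even, and on the right a position
    is added to itself.\<close>
  then show ?thesis
    using even_card_arc[OF x] by simp
next
  case False
  then have "occ x i \<noteq> occ y j" for i j
    using nth_occ[OF x] nth_occ[OF y] by metis
  then show ?thesis
    unfolding interlaced_iff_arc[OF x y False]
    by (intro odd_card_arc_Int occ_less occ_neq even_length odd_occ x y)
qed

text \<open>A formula free of colours, which allows comparing two framings of one word.\<close>

lemma intersection_form_parity: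
  assumes "x \<in> chords C" "y \<in> chords C"
  shows "intersection_form C \<phi> x y = rosenstiehl_form C x y
    + of_bool (interlaced C x y \<and> odd (occ x Infty + occ y Infty))"
  unfolding intersection_form_arcs[OF assms] bit_of_nat odd_card_arcs[OF assms] ..

end

text \<open>Along the word, exactly one of framing value and colour changes at every step.\<close>

lemma bicolouring_parity:
  assumes "associated_bicolouring C \<phi> \<chi>" "p < length C"
  shows "even p \<longleftrightarrow> (\<phi> p = \<phi> 0 \<longleftrightarrow> \<chi> (C ! p) = \<chi> (C ! 0))"
  using assms(2)
proof (induction p)
  case 0
  then show ?case by simp
next
  case (Suc p)
  then have "\<phi> p = \<phi> (Suc p) \<longleftrightarrow> \<chi> (C ! p) \<noteq> \<chi> (C ! Suc p)"
    using assms(1) unfolding associated_bicolouring_def Let_def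
    by (metis Suc_lessD mod_less)
  moreover have "even p \<longleftrightarrow> (\<phi> p = \<phi> 0 \<longleftrightarrow> \<chi> (C ! p) = \<chi> (C ! 0))"
    using Suc by simp
  ultimately show ?case
    by (cases "\<phi> p"; cases "\<phi> (Suc p)"; cases "\<phi> 0"; cases "\<chi> (C ! p)";
      cases "\<chi> (C ! Suc p)"; cases "\<chi> (C ! 0)") auto
qed

section \<open>The intersection form in terms of the coloured graph\<close>

lemma intersection_form_eq:
  assumes D: "bicolourable_framed_diagram C \<phi> \<chi>" and x: "x \<in> chords C" and y: "y \<in> chords C"
  shows "intersection_form C \<phi> x y = rosenstiehl_form C x y + colour_coboundary C \<chi> x y"
proof -
  interpret bicolourable_diagram C \<phi>
    using D by unfold_locales (auto simp: bicolourable_framed_diagram_def)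
  \<comment> \<open>At \<open>Infty\<close> positions the framing value is fixed, so parity detects
    the colour up to a constant set by position 0. This constant cancels when two chords are
    compared.\<close>
  have "even (occ z Infty) \<longleftrightarrow> (Infty = \<phi> 0 \<longleftrightarrow> \<chi> z = \<chi> (C ! 0))" if "z \<in> chords C" for z
    using D bicolouring_parity[of C \<phi> \<chi> "occ z Infty"] occ_less[OF that] nth_occ[OF that]
      frame_occ[OF that] by (simp add: bicolourable_framed_diagram_def)
  from this[OF x] this[OF y] have "odd (occ x Infty + occ y Infty) \<longleftrightarrow> \<chi> x \<noteq> \<chi> y"
    by (cases "\<chi> x"; cases "\<chi> y"; cases "\<chi> (C ! 0)") auto
  then show ?thesis
    unfolding intersection_form_parity[OF x y] colour_coboundary_def colour_form_def by simp
qed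

text \<open>Reindexing the matrix product along \<open>f\<close> shows that the Rosenstiehl form is
  a graph invariant.\<close>

lemma graph_iso_rosenstiehl_form:
  assumes "graph_iso C D f" and x: "x \<in> chords C" and y: "y \<in> chords C"
  shows "rosenstiehl_form D (f x) (f y) = rosenstiehl_form C x y"
proof -
  have f: "bij_betw f (chords C) (chords D)"
    and adj: "\<And>u v. u \<in> chords C \<Longrightarrow> v \<in> chords C \<Longrightarrow> adjacency D (f u) (f v) = adjacency C u v"
    using assms(1) by (simp_all add: graph_iso_def adjacency_def)
  have "(\<Sum>z\<in>chords D. adjacency D (f x) z * adjacency D z (f y))
      = (\<Sum>z\<in>chords C. adjacency D (f x) (f z) * adjacency D (f z) (f y))"
    by (rule sum.reindex_bij_betw[OF f, symmetric])
  also have "\<dots> = (\<Sum>z\<in>chords C. adjacency C x z * adjacency C z y)"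
    using adj x y by (intro sum.cong) simp_all
  finally show ?thesis
    by (simp add: rosenstiehl_form_def adjacency_squared_def adj[OF x y])
qed

text \<open>Equality of the intersection forms says that the parity \<open>g\<close> below is constant along the edges of
  the interlace graph, and \<open>g x\<close> decides whether the two framings agree on \<open>x\<close>.\<close>

lemma intersection_form_determines_framing:
  assumes C: "chord_diagram C" "bicolourable C" and \<phi>: "framing C \<phi>" and \<psi>: "framing C \<psi>"
    and eq: "\<And>x y. x \<in> chords C \<Longrightarrow> y \<in> chords C
      \<Longrightarrow> intersection_form C \<psi> x y = intersection_form C \<phi> x y"
  shows "equal_up_to_component_inversions C \<phi> \<psi>"
proof -
  interpret P: bicolourable_diagram C \<phi> using C \<phi> by unfold_locales
  interpret Q: bicolourable_diagram C \<psi> using C \<psi> by unfold_locales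
  define g where "g x \<longleftrightarrow> odd (P.occ x Infty + Q.occ x Infty)" for x
  have edge: "g x = g y" if "interlaced C x y" for x y
  proof -
    have xy: "x \<in> chords C" "y \<in> chords C"
      using that unfolding interlaced_def by (metis nth_mem order.strict_trans)+
    \<comment> \<open>The Rosenstiehl terms depend on \<open>C\<close> only and cancel.\<close>
    have "odd (Q.occ x Infty + Q.occ y Infty) \<longleftrightarrow> odd (P.occ x Infty + P.occ y Infty)"
      using eq[OF xy] that unfolding P.intersection_form_parity[OF xy] Q.intersection_form_parity[OF xy]
      by (simp add: of_bool_eq_iff)
    then show ?thesis by (auto simp: g_def)
  qed
  have connected: "g x = g y" if "(interlaced C)\<^sup>*\<^sup>* x y" for x y
    using that by induction (auto dest: edge)
  have agree: "\<psi> p = (if g (C ! p) then recip (\<phi> p) else \<phi> p)" if p: "p < length C" for p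
  proof -
    let ?x = "C ! p"
    have x: "?x \<in> chords C" using p by simp
    have "{P.occ ?x Infty, P.occ ?x Zero} = {Q.occ ?x Infty, Q.occ ?x Zero}"
      using P.positions_eq[OF x] Q.positions_eq[OF x] by simp
    then consider "P.occ ?x Infty = Q.occ ?x Infty" "P.occ ?x Zero = Q.occ ?x Zero"
      | "P.occ ?x Infty = Q.occ ?x Zero" "P.occ ?x Zero = Q.occ ?x Infty"
      by (auto simp: doubleton_eq_iff)
    then show ?thesis
    proof cases
      case 1
      then have "P.occ ?x j = Q.occ ?x j" for j by (cases j) auto
      then have "\<phi> p = \<psi> p"
        using P.position_cases[OF p] Q.frame_occ[OF x] by metis
      moreover have "\<not> g ?x" using 1 by (simp add: g_def)
      ultimately show ?thesis by simp
    next
      case 2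
      then have "P.occ ?x j = Q.occ ?x (recip j)" for j by (cases j) auto
      then have "\<psi> p = recip (\<phi> p)"
        using P.position_cases[OF p] Q.frame_occ[OF x] by metis
      \<comment> \<open>The two positions of a chord have opposite parities, so exchanging them is
        seen by \<open>g\<close>.\<close>
      moreover have "g ?x" using 2 Q.odd_occ[OF x] by (simp add: g_def add.commute)
      ultimately show ?thesis by simp
    qed
  qed
  let ?comp = "\<lambda>x. {y \<in> chords C. (interlaced C)\<^sup>*\<^sup>* x y}"
  \<comment> \<open>As \<open>g\<close> is constant on components, the union of those meeting
    \<open>g\<close> contains no other chords.\<close>
  let ?K = "?comp ` {x \<in> chords C. g x}"
  have "?K \<subseteq> connected_components C"
    by (auto simp: connected_components_def)
  moreover have "x \<in> \<Union>?K \<longleftrightarrow> g x" if "x \<in> chords C" for x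
    using that connected by auto
  ultimately show ?thesis
    unfolding equal_up_to_component_inversions_def using agree nth_mem by (intro exI[of _ ?K]) auto
qed

section \<open>Transfer of the forms along graph isomorphisms\<close>

lemma bit_add_diff [simp]: "a + b - a = b" "a + b - b = a" for a b :: bit
  by (cases a; cases b; simp)+

text \<open>Off the edges the coboundary is zero by convention, and equal colours make the colour
  form zero too.\<close>

lemma colour_coboundary_eq_colour_form:
  "interlaced C x y \<or> \<chi> x = \<chi> y \<Longrightarrow> colour_coboundary C \<chi> x y = colour_form \<chi> x y"
  by (auto simp: colour_coboundary_def colour_form_def)

text \<open>The Rosenstiehl forms correspond under \<open>f\<close> and cancel. One direction
  reconstructs the intersection form from colours, the other recovers the coboundary.\<close>

lemma graph_iso_intersection_form_iff:
  assumes "bicolourable_framed_diagram C \<phi> \<chi>" "bicolourable_framed_diagram D \<psi> \<eta>"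
    and iso: "graph_iso C D f" and xy: "x \<in> chords C" "y \<in> chords C"
  shows "intersection_form D \<psi> (f x) (f y) = intersection_form C \<phi> x y
    \<longleftrightarrow> colour_coboundary D \<eta> (f x) (f y) = colour_coboundary C \<chi> x y"
proof -
  have "f x \<in> chords D" "f y \<in> chords D"
    using iso xy by (auto simp: graph_iso_def bij_betw_def)
  then show ?thesis
    using assms by (simp add: intersection_form_eq graph_iso_rosenstiehl_form[OF iso])
qed

theorem theorem2p17:
  fixes C :: "'a list" and \<phi> :: "nat \<Rightarrow> frame_value" and \<chi> :: "'a \<Rightarrow> colour"
  assumes "bicolourable_framed_diagram C \<phi> \<chi>"
  shows
    "(\<forall>x\<in>chords C. \<forall>y\<in>chords C.
        intersection_form C \<phi> x y - colour_coboundary C \<chi> x y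
          = rosenstiehl_form C x y)
   \<and> (\<forall>x\<in>chords C. \<forall>y\<in>chords C. interlaced C x y \<or> \<chi> x = \<chi> y \<longrightarrow>
        intersection_form C \<phi> x y - colour_form \<chi> x y
          = rosenstiehl_form C x y)
   \<and> (\<forall>(D :: 'b list) \<psi> \<eta> f.
        bicolourable_framed_diagram D \<psi> \<eta> \<and> graph_iso C D f \<and>
        (\<forall>x\<in>chords C. \<eta> (f x) = \<chi> x) \<longrightarrow>
        (\<forall>x\<in>chords C. \<forall>y\<in>chords C.
           intersection_form D \<psi> (f x) (f y) = intersection_form C \<phi> x y))
   \<and> (\<forall>(D :: 'b list) \<psi> \<eta> f.
        bicolourable_framed_diagram D \<psi> \<eta> \<and> graph_iso C D f \<and>
        (\<forall>x\<in>chords C. \<forall>y\<in>chords C.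
           intersection_form D \<psi> (f x) (f y) = intersection_form C \<phi> x y) \<longrightarrow>
        (\<forall>x\<in>chords C. \<forall>y\<in>chords C.
           colour_coboundary D \<eta> (f x) (f y) = colour_coboundary C \<chi> x y))
   \<and> (\<forall>\<psi>. framing C \<psi> \<and>
        (\<forall>x\<in>chords C. \<forall>y\<in>chords C. intersection_form C \<psi> x y = intersection_form C \<phi> x y) \<longrightarrow>
        equal_up_to_component_inversions C \<phi> \<psi>)
   \<and> (even_common_neighbours C \<longrightarrow>
        (\<forall>(D :: 'b list) \<psi> \<eta> f.
           bicolourable_framed_diagram D \<psi> \<eta> \<and> graph_iso C D f \<and>
           (\<forall>x\<in>chords C. \<forall>y\<in>chords C. interlaced C x y \<longrightarrow>
              colour_form \<eta> (f x) (f y) = colour_form \<chi> x y) \<longrightarrow>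
           (\<forall>x\<in>chords C. \<forall>y\<in>chords C.
              intersection_form D \<psi> (f x) (f y) = intersection_form C \<phi> x y)))"
proof -
  note C = assms
  have coboundary: "intersection_form C \<phi> x y - colour_coboundary C \<chi> x y = rosenstiehl_form C x y"
    if "x \<in> chords C" "y \<in> chords C" for x y
    by (simp only: intersection_form_eq[OF C that] bit_add_diff)
  \<comment> \<open>Since \<open>f\<close> also preserves non-edges, both coboundaries vanish there
    and only edges need checking.\<close>
  have same_edges: "colour_coboundary D \<eta> (f x) (f y) = colour_coboundary C \<chi> x y"
    if "graph_iso C D f" "x \<in> chords C" "y \<in> chords C"
      "interlaced C x y \<longrightarrow> colour_form \<eta> (f x) (f y) = colour_form \<chi> x y"
    for D :: "'b list" and \<eta> f x y
    using that by (simp add: colour_coboundary_def graph_iso_def)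
  show ?thesis
  proof (intro conjI allI impI ballI; (elim conjE)?)
    fix x y assume "x \<in> chords C" "y \<in> chords C" "interlaced C x y \<or> \<chi> x = \<chi> y"
    then show "intersection_form C \<phi> x y - colour_form \<chi> x y = rosenstiehl_form C x y"
      using coboundary by (metis colour_coboundary_eq_colour_form)
  next
    fix D :: "'b list" and \<psi> \<eta> f x y
    assume D: "bicolourable_framed_diagram D \<psi> \<eta>" "graph_iso C D f"
      and "\<forall>x\<in>chords C. \<eta> (f x) = \<chi> x" and xy: "x \<in> chords C" "y \<in> chords C"
    then show "intersection_form D \<psi> (f x) (f y) = intersection_form C \<phi> x y"
      unfolding graph_iso_intersection_form_iff[OF C D xy]
      by (intro same_edges) (simp_all add: colour_form_def)
  next
    fix D :: "'b list" and \<psi> \<eta> f x y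
    assume D: "bicolourable_framed_diagram D \<psi> \<eta>" "graph_iso C D f"
      and "\<forall>x\<in>chords C. \<forall>y\<in>chords C. intersection_form D \<psi> (f x) (f y) = intersection_form C \<phi> x y"
      and xy: "x \<in> chords C" "y \<in> chords C"
    then show "colour_coboundary D \<eta> (f x) (f y) = colour_coboundary C \<chi> x y"
      using graph_iso_intersection_form_iff[OF C D xy] by simp
  next
    fix \<psi> assume "framing C \<psi>"
      "\<forall>x\<in>chords C. \<forall>y\<in>chords C. intersection_form C \<psi> x y = intersection_form C \<phi> x y"
    with C show "equal_up_to_component_inversions C \<phi> \<psi>"
      by (intro intersection_form_determines_framing) (simp_all add: bicolourable_framed_diagram_def)
  next
    fix D :: "'b list" and \<psi> \<eta> f x y
    assume D: "bicolourable_framed_diagram D \<psi> \<eta>" "graph_iso C D f"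
      and "\<forall>x\<in>chords C. \<forall>y\<in>chords C. interlaced C x y \<longrightarrow>
        colour_form \<eta> (f x) (f y) = colour_form \<chi> x y"
      and xy: "x \<in> chords C" "y \<in> chords C"
    then show "intersection_form D \<psi> (f x) (f y) = intersection_form C \<phi> x y"
      unfolding graph_iso_intersection_form_iff[OF C D xy]
      by (intro same_edges) simp_all
  qed (rule coboundary)
qed

end
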